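(* Let $\alpha,\beta\in\mathbb{C}$ and let $(P_n(x))_{n\ge 0}$ be the family of (Laurent biorthogonal) polynomials defined by $P_0(x)=1$, $P_1(x)=x-\alpha$ and $$P_n(x)=(x-\alpha)P_{n-1}(x)-\beta x P_{n-2}(x),\qquad n\ge 2.$$ Then the coefficient array of the polynomials $P_n(x)$ is the Riordan array $$\left(\frac{1}{1+\alpha x},\ \frac{x(1-\beta x)}{1+\alpha x}\right).$$
   Context: For formal power series $g(x)=1+g_1x+g_2x^2+\cdots$ and $f(x)=x+f_2x^2+\cdots$, the Riordan array $(g,f)$ is the infinite lower-triangular matrix with rows and columns indexed by $0,1,2,\ldots$ whose $(n,k)$ entry is $[x^n]\,g(x)f(x)^k$, where $[x^n]$ denotes extraction of the coefficient of $x^n$. The coefficient array of a sequence of polynomials $P_n(x)=\sum_{k=0}^n d_{n,k}x^k$ (with $\deg P_n\le n$) is the infinite lower-triangular matrix $(d_{n,k})_{n,k\ge 0}$. *)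

theory Defs
  imports
    Complex_Main
    "HOL-Computational_Algebra.Polynomial"
    "HOL-Computational_Algebra.Formal_Power_Series"
begin

text \<open>Infinite matrices are functions of the row index and the column index, both starting at 0.\<close>

definition lower_triangular :: "(nat \<Rightarrow> nat \<Rightarrow> 'a::zero) \<Rightarrow> bool" where
  "lower_triangular M \<longleftrightarrow> (\<forall>n k. n < k \<longrightarrow> M n k = 0)"

text \<open>The series \<open>g = 1 + g\<^sub>1 x + \<dots>\<close> and \<open>f = x + f\<^sub>2 x\<^sup>2 + \<dots>\<close> that define a Riordan array.\<close>

definition riordan_pair :: "'a::comm_ring_1 fps \<Rightarrow> 'a fps \<Rightarrow> bool" where
  "riordan_pair g f \<longleftrightarrow> fps_nth g 0 = 1 \<and> fps_nth f 0 = 0 \<and> fps_nth f 1 = 1"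

definition riordan_array :: "'a::comm_ring_1 fps \<Rightarrow> 'a fps \<Rightarrow> nat \<Rightarrow> nat \<Rightarrow> 'a" where
  "riordan_array g f n k = fps_nth (g * f ^ k) n"

text \<open>The relation determines \<open>d\<close> uniquely, and it forces \<open>degree (P n) \<le> n\<close>.\<close>

definition is_coefficient_array ::
    "(nat \<Rightarrow> 'a::comm_ring_1 poly) \<Rightarrow> (nat \<Rightarrow> nat \<Rightarrow> 'a) \<Rightarrow> bool" where
  "is_coefficient_array P d \<longleftrightarrow>
     lower_triangular d \<and> (\<forall>n. P n = (\<Sum>k\<le>n. monom (d n k) k))"

end

theory Submission
  imports Defs
begin

text \<open>Read the coefficient array by columns.  Let \<open>C k\<close> be the generating function, in the
  index \<open>n\<close>, of the coefficients of \<open>x ^ k\<close> in \<open>P n\<close>.  Comparing coefficients of \<open>x ^ k\<close> in the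
  three-term recurrence turns it into a first-order recurrence for the columns:
  \<open>(1 + \<alpha> X) C 0 = 1\<close> and \<open>(1 + \<alpha> X) C (k + 1) = X (1 - \<beta> X) C k\<close>.  The term \<open>-\<alpha> P (n - 1)\<close>
  keeps the exponent of \<open>x\<close> and is moved to the left; the terms \<open>x P (n - 1)\<close> and
  \<open>-\<beta> x P (n - 2)\<close> raise it by one and give \<open>X\<close> and \<open>-\<beta> X\<^sup>2\<close> on the right.
  So each column is the preceding one times \<open>f = X (1 - \<beta> X) / (1 + \<alpha> X)\<close>, starting from
  \<open>g = 1 / (1 + \<alpha> X)\<close>, which says \<open>C k = g f ^ k\<close>.

  The series \<open>f\<close> has no constant term, so \<open>f ^ k\<close> starts at order \<open>k\<close> and the array is
  lower triangular.  Equality of the columns therefore also gives \<open>degree (P n) \<le> n\<close>.\<close>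

lemma riordan_array_lower_triangular:
  fixes g f :: "'a::comm_ring_1 fps"
  assumes "fps_nth f 0 = 0"
  shows "lower_triangular (riordan_array g f)"
  unfolding lower_triangular_def riordan_array_def
proof (intro allI impI)
  fix n k :: nat
  assume "n < k"
  have "fps_nth (f ^ k) i = 0" if "i \<le> n" for i
    using startsby_zero_power_prefix[OF assms, of k] that \<open>n < k\<close> by simp
  then show "fps_nth (g * f ^ k) n = 0"
    by (simp add: fps_mult_nth)
qed

lemma is_coefficient_arrayI:
  fixes P :: "nat \<Rightarrow> 'a::comm_ring_1 poly"
  assumes "lower_triangular d" and "\<And>n k. coeff (P n) k = d n k"
  shows "is_coefficient_array P d"
proof -
  have "P n = (\<Sum>k\<le>n. monom (d n k) k)" for n
    using assms by (intro poly_eqI) (auto simp: coeff_sum lower_triangular_def)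
  with assms(1) show ?thesis
    by (simp add: is_coefficient_array_def)
qed

definition coeff_column :: "(nat \<Rightarrow> 'a::zero poly) \<Rightarrow> nat \<Rightarrow> 'a fps" where
  "coeff_column P k = Abs_fps (\<lambda>n. coeff (P n) k)"

lemma coeff_column_nth [simp]: "fps_nth (coeff_column P k) n = coeff (P n) k"
  by (simp add: coeff_column_def)

lemma linear_fps_mult_nth_Suc:
  fixes a :: "'a::comm_ring_1"
  shows "fps_nth ((1 + fps_const a * fps_X) * h) (Suc n) = fps_nth h (Suc n) + a * fps_nth h n"
  by (simp add: distrib_right mult.assoc)

context
  fixes \<alpha> \<beta> :: "'a::comm_ring_1" and P :: "nat \<Rightarrow> 'a poly"
  assumes P0: "P 0 = 1"
    and P1: "P 1 = [:-\<alpha>, 1:]"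
    and P_rec: "\<And>n. n \<ge> 2 \<Longrightarrow> P n = [:-\<alpha>, 1:] * P (n - 1) - [:0, \<beta>:] * P (n - 2)"
begin

lemma P_Suc_Suc: "P (Suc (Suc n)) = [:-\<alpha>, 1:] * P (Suc n) - [:0, \<beta>:] * P n"
  using P_rec[of "Suc (Suc n)"] by simp

lemma coeff_column_0: "(1 + fps_const \<alpha> * fps_X) * coeff_column P 0 = 1"
proof (rule fps_ext)
  fix n
  show "fps_nth ((1 + fps_const \<alpha> * fps_X) * coeff_column P 0) n = fps_nth 1 n"
  proof (cases n)
    case 0
    then show ?thesis by (simp add: P0)
  next
    case (Suc m)
    have "coeff (P (Suc m)) 0 = - \<alpha> * coeff (P m) 0"
      using P0 P1 by (cases m) (simp_all add: P_Suc_Suc)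
    then show ?thesis
      unfolding Suc linear_fps_mult_nth_Suc by simp
  qed
qed

text \<open>In row 1 the right-hand side sees only \<open>P 0\<close>, since the factor \<open>\<beta> X\<^sup>2\<close> starts to
  contribute in row 2; this is why the recurrence needs \<open>P 1 = (x - \<alpha>) P 0\<close> as its start.
  The sign sits inside \<open>fps_const\<close> so that both sides have a factor of the form \<open>1 + a X\<close>.\<close>

lemma coeff_column_Suc:
  "(1 + fps_const \<alpha> * fps_X) * coeff_column P (Suc k)
     = fps_X * (1 + fps_const (- \<beta>) * fps_X) * coeff_column P k"
proof (rule fps_ext)
  fix n
  consider "n = 0" | "n = 1" | m where "n = Suc (Suc m)"
    by (metis One_nat_def not0_implies_Suc)
  then show "fps_nth ((1 + fps_const \<alpha> * fps_X) * coeff_column P (Suc k)) n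
      = fps_nth (fps_X * (1 + fps_const (- \<beta>) * fps_X) * coeff_column P k) n"
  proof cases
    case 1
    then show ?thesis by (simp add: P0)
  next
    case 2
    then show ?thesis
      using P1 unfolding 2 One_nat_def mult.assoc[of fps_X] linear_fps_mult_nth_Suc
      by (cases k) (simp_all add: P0)
  next
    case 3
    then show ?thesis
      unfolding 3 mult.assoc[of fps_X] linear_fps_mult_nth_Suc
      by (simp add: P_Suc_Suc linear_fps_mult_nth_Suc del: fps_const_neg)
  qed
qed

end

theorem proposition1:
  fixes \<alpha> \<beta> :: complex
    and P :: "nat \<Rightarrow> complex poly"
    and g f :: "complex fps"
  assumes P0: "P 0 = 1"
    and P1: "P 1 = [:-\<alpha>, 1:]"
    and P_rec: "\<And>n. n \<ge> 2 \<Longrightarrow> P n = [:-\<alpha>, 1:] * P (n - 1) - [:0, \<beta>:] * P (n - 2)"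
  defines "g \<equiv> 1 / (1 + fps_const \<alpha> * fps_X)"
    and "f \<equiv> (fps_X * (1 - fps_const \<beta> * fps_X)) / (1 + fps_const \<alpha> * fps_X)"
  shows "riordan_pair g f \<and> is_coefficient_array P (riordan_array g f)"
proof -
  define u :: "complex fps" where "u = 1 + fps_const \<alpha> * fps_X"
  define v :: "complex fps" where "v = fps_X * (1 + fps_const (- \<beta>) * fps_X)"
  have u0: "fps_nth u 0 = 1"
    by (simp add: u_def)
  have u_inv: "inverse u * u = 1"
    using u0 by (simp add: inverse_mult_eq_1)
  have g: "g = inverse u"
    using u0 by (simp add: g_def u_def fps_divide_unit)
  have f: "f = v * inverse u"
    using u0 by (simp add: f_def u_def v_def fps_divide_unit flip: fps_const_neg)
  have solve: "c = b * inverse u" if "u * c = b" for b c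
    using u_inv that by (metis mult.assoc mult.commute mult_1)
  have column: "coeff_column P k = g * f ^ k" for k
  proof (induction k)
    case 0
    show ?case
      using solve[OF coeff_column_0[OF P0 P1 P_rec, folded u_def]] by (simp add: g)
  next
    case (Suc k)
    have "coeff_column P (Suc k) = (v * coeff_column P k) * inverse u"
      by (rule solve[OF coeff_column_Suc[OF P0 P1 P_rec, folded u_def v_def]])
    then show ?case
      by (simp add: Suc.IH f mult_ac)
  qed
  have pair: "riordan_pair g f"
    using u0 by (simp add: riordan_pair_def g f v_def fps_mult_nth_1 mult.assoc)
  have "coeff (P n) k = riordan_array g f n k" for n k
    by (simp add: riordan_array_def flip: column)
  moreover have "lower_triangular (riordan_array g f)"
    using pair by (simp add: riordan_array_lower_triangular riordan_pair_def)
  ultimately show ?thesis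
    using pair by (simp add: is_coefficient_arrayI)
qed

end
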